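(* Fix an expert $i$ and attribute $j$ and an integer $K_{ij}\ge1$. Let $\mathcal P_{ij}$ be a partial preference context of utility density functions on $[0,K_{ij}]$ and let $\bar v(x)=1/K_{ij}$ be the uniform utility density function. Then maximum entropy utility is the special case of minimum cross-entropy utility with uniform target utility density: $$\underset{u_{ij}\in\mathcal P_{ij}}{\arg\max}\ -\int_0^{K_{ij}}u_{ij}(x)\ln\big(u_{ij}(x)\big)\,dx\;=\;\underset{u_{ij}\in\mathcal P_{ij}}{\arg\min}\ \int_0^{K_{ij}}u_{ij}(x)\ln\Big(\frac{u_{ij}(x)}{\bar v(x)}\Big)\,dx.$$
   Context: $[n]=\{1,\dots,n\}$; $0\ln 0=0$. The partial preference context $\mathcal P_{ij}$ consists of all integrable $u_{ij}:[0,K_{ij}]\to[0,\infty)$ with $\int_0^{K_{ij}}u_{ij}\,dx=1$ satisfying finitely many given constraints, each of one of the forms (with given ranks $r\in[K_{ij}]$ and given constants $\alpha,\beta,\gamma$): ratio scale: $\int_0^ru_{ij}\,dx-\alpha\int_0^{r-1}u_{ij}\,dx=0$; absolute difference: $\int_0^ru_{ij}\,dx-\int_0^{r-1}u_{ij}\,dx=\beta$; lower bound: $\int_0^ru_{ij}\,dx=\gamma$. Integrals of $u\ln u$ take values in $(-\infty,+\infty]$. *)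

theory Defs
  imports "HOL-Analysis.Analysis"
begin

(* Utility densities on [0,K]. Functions on [0,K] are represented by extensional total functions,
   so that equality of such functions is equality on [0,K]. *)
definition utility_densities :: "nat \<Rightarrow> (real \<Rightarrow> real) set" where
  "utility_densities K =
     {u \<in> {0..real K} \<rightarrow>\<^sub>E {0..}.
        set_integrable lebesgue {0..real K} u \<and> (LINT x:{0..real K}|lebesgue. u x) = 1}"

datatype preference =
    Ratio_Scale (rank: nat) real
  | Absolute_Difference (rank: nat) real
  | Lower_Bound (rank: nat) real

fun satisfies :: "(real \<Rightarrow> real) \<Rightarrow> preference \<Rightarrow> bool" where
  "satisfies u (Ratio_Scale r \<alpha>) \<longleftrightarrow>
     (LINT x:{0..real r}|lebesgue. u x) - \<alpha> * (LINT x:{0..real r - 1}|lebesgue. u x) = 0"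
| "satisfies u (Absolute_Difference r \<beta>) \<longleftrightarrow>
     (LINT x:{0..real r}|lebesgue. u x) - (LINT x:{0..real r - 1}|lebesgue. u x) = \<beta>"
| "satisfies u (Lower_Bound r \<gamma>) \<longleftrightarrow>
     (LINT x:{0..real r}|lebesgue. u x) = \<gamma>"

definition preference_context :: "nat \<Rightarrow> preference set \<Rightarrow> (real \<Rightarrow> real) set" where
  "preference_context K C = {u \<in> utility_densities K. \<forall>c\<in>C. satisfies u c}"

definition uniform_density :: "nat \<Rightarrow> real \<Rightarrow> real" where
  "uniform_density K = (\<lambda>x\<in>{0..real K}. 1 / real K)"

(* Extended-real Lebesgue integral: integral of the positive part minus integral of the negative
   part (ennreal maps negative reals to 0). It is meaningful when one of the two is finite; the
   negative part of u ln u is at most 1/e, so for the entropy integrals over [0,K] the second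
   one is finite and the value lies in (-\<infinity>, \<infinity>]. Note that ln 0 = 0, hence 0 * ln 0 = 0. *)
definition ext_integral :: "real set \<Rightarrow> (real \<Rightarrow> real) \<Rightarrow> ereal" where
  "ext_integral S f =
     enn2ereal (\<integral>\<^sup>+x\<in>S. ennreal (f x) \<partial>lebesgue) - enn2ereal (\<integral>\<^sup>+x\<in>S. ennreal (- f x) \<partial>lebesgue)"

lemma ext_integral_eq_set_integral:
  assumes "set_integrable lebesgue S f"
  shows "ext_integral S f = ereal (LINT x:S|lebesgue. f x)"
proof -
  let ?g = "\<lambda>x. indicator S x *\<^sub>R f x"
  have g: "integrable lebesgue ?g"
    using assms by (simp add: set_integrable_def)
  have p: "(\<integral>\<^sup>+x\<in>S. ennreal (f x) \<partial>lebesgue) = (\<integral>\<^sup>+x. ennreal (?g x) \<partial>lebesgue)"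
    by (intro nn_integral_cong) (auto simp: indicator_def)
  have n: "(\<integral>\<^sup>+x\<in>S. ennreal (- f x) \<partial>lebesgue) = (\<integral>\<^sup>+x. ennreal (- ?g x) \<partial>lebesgue)"
    by (intro nn_integral_cong) (auto simp: indicator_def)
  obtain r q where "0 \<le> r" "0 \<le> q"
    "(\<integral>\<^sup>+x. ennreal (?g x) \<partial>lebesgue) = ennreal r"
    "(\<integral>\<^sup>+x. ennreal (- ?g x) \<partial>lebesgue) = ennreal q"
    "integral\<^sup>L lebesgue ?g = r - q"
    using g by (rule integrableE)
  then show ?thesis
    by (simp add: ext_integral_def p n set_lebesgue_integral_def enn2ereal_ennreal)
qed

lemma uniform_density_in_utility_densities:
  assumes "K \<ge> 1"
  shows "uniform_density K \<in> utility_densities K"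
proof -
  have eq: "(\<lambda>x. indicator {0..real K} x *\<^sub>R uniform_density K x)
      = (\<lambda>x. indicator {0..real K} x *\<^sub>R (1 / real K))"
    by (auto simp: uniform_density_def indicator_def)
  show ?thesis
    using assms
    by (auto simp: utility_densities_def set_integrable_def set_lebesgue_integral_def eq
        simp del: scaleR_conv_of_real real_scaleR_def)
       (auto simp: uniform_density_def)
qed

end

theory Submission
  imports Defs
begin

text \<open>For a density \<open>u\<close> on \<open>[0, K]\<close> the identity \<open>u ln (u / (1/K)) = u ln u + u ln K\<close> integrates to
  \<^emph>\<open>cross-entropy = - entropy + ln K\<close>. This holds in \<open>(-\<infinity>, \<infinity>]\<close>, because the negative part of
  \<open>u ln u\<close> is bounded and \<open>u ln K\<close> is integrable. A finite constant does not affect the optimisers.\<close>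

lemma ext_integral_cong:
  assumes "\<And>x. x \<in> S \<Longrightarrow> f x = g x"
  shows "ext_integral S f = ext_integral S g"
  unfolding ext_integral_def using assms
  by (intro arg_cong2[where f = "(-)"] arg_cong[where f = enn2ereal] nn_integral_cong)
    (auto simp: indicator_def)

text \<open>Only the negative part of \<open>f\<close> has to be finite, so the integral of
  \<open>f\<close> may be \<infinity>. Positive and negative parts are therefore compared through
  sums in \<open>ennreal\<close>, and subtraction is done only after every subtracted term is known
  to be finite.\<close>

lemma ext_integral_add:
  assumes f: "set_borel_measurable lebesgue S f"
    and neg: "(\<integral>\<^sup>+x\<in>S. ennreal (- f x) \<partial>lebesgue) < \<infinity>"
    and g: "set_integrable lebesgue S g"
  shows "ext_integral S (\<lambda>x. f x + g x) = ext_integral S f + ereal (LINT x:S|lebesgue. g x)"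
proof -
  define F where "F x = indicator S x *\<^sub>R f x" for x
  define G where "G x = indicator S x *\<^sub>R g x" for x
  have F[measurable]: "F \<in> borel_measurable lebesgue"
    using f by (simp add: set_borel_measurable_def F_def[abs_def])
  have intG: "integrable lebesgue G"
    using g by (simp add: set_integrable_def G_def[abs_def])
  then have G[measurable]: "G \<in> borel_measurable lebesgue" by simp
  define I where "I h = (\<integral>\<^sup>+x. ennreal (h x) \<partial>lebesgue)" for h :: "real \<Rightarrow> real"
  have I_eq:
    "(\<integral>\<^sup>+x\<in>S. ennreal (f x) \<partial>lebesgue) = I F"
    "(\<integral>\<^sup>+x\<in>S. ennreal (- f x) \<partial>lebesgue) = I (\<lambda>x. - F x)"
    "(\<integral>\<^sup>+x\<in>S. ennreal (f x + g x) \<partial>lebesgue) = I (\<lambda>x. F x + G x)"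
    "(\<integral>\<^sup>+x\<in>S. ennreal (- (f x + g x)) \<partial>lebesgue) = I (\<lambda>x. - (F x + G x))"
    unfolding I_def F_def G_def by (auto intro!: nn_integral_cong simp: indicator_def)
  obtain r q where rq: "0 \<le> r" "0 \<le> q" "I G = ennreal r" "I (\<lambda>x. - G x) = ennreal q"
    "integral\<^sup>L lebesgue G = r - q"
    using intG unfolding I_def by (rule integrableE)
  obtain n where n: "0 \<le> n" "I (\<lambda>x. - F x) = ennreal n"
    using neg by (cases "I (\<lambda>x. - F x)") (auto simp: I_eq)
  \<comment> \<open>The negative part is subadditive, so that of the sum also has a finite integral
    \<open>m\<close>.\<close>
  have "I (\<lambda>x. - (F x + G x)) \<le> (\<integral>\<^sup>+x. ennreal (- F x) + ennreal (- G x) \<partial>lebesgue)"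
    unfolding I_def
    by (intro nn_integral_mono)
      (auto simp: ennreal_plus_if ennreal_neg intro!: ennreal_leI)
  also have "\<dots> = ennreal n + ennreal q"
    using n rq by (simp add: I_def nn_integral_add)
  finally have "I (\<lambda>x. - (F x + G x)) < \<infinity>"
    by (simp add: le_less_trans)
  then obtain m where m: "0 \<le> m" "I (\<lambda>x. - (F x + G x)) = ennreal m"
    by (cases "I (\<lambda>x. - (F x + G x))") auto
  \<comment> \<open>With h+ and h- for the parts of h, the pointwise identity (F+G)+ + F- + G- =
    (F+G)- + F+ + G+ has no differences and holds also when an integral is infinite.\<close>
  have "I (\<lambda>x. F x + G x) + I (\<lambda>x. - F x) + I (\<lambda>x. - G x)
      = (\<integral>\<^sup>+x. ennreal (F x + G x) + ennreal (- F x) + ennreal (- G x) \<partial>lebesgue)"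
    unfolding I_def by (simp add: nn_integral_add)
  also have "\<dots> = (\<integral>\<^sup>+x. ennreal (- (F x + G x)) + ennreal (F x) + ennreal (G x) \<partial>lebesgue)"
    by (intro nn_integral_cong) (auto simp: ennreal_plus_if ennreal_neg)
  also have "\<dots> = I (\<lambda>x. - (F x + G x)) + I F + I G"
    unfolding I_def by (simp add: nn_integral_add)
  finally have bal: "I (\<lambda>x. F x + G x) + ennreal n + ennreal q = ennreal m + I F + ennreal r"
    using rq n m by simp
  have "enn2ereal (I (\<lambda>x. F x + G x)) - ereal m = enn2ereal (I F) - ereal n + ereal (r - q)"
  proof (cases "I F")
    case (real p)
    then obtain s where s: "0 \<le> s" "I (\<lambda>x. F x + G x) = ennreal s"
      using bal rq n m by (cases "I (\<lambda>x. F x + G x)") (auto simp flip: ennreal_plus)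
    have "s + n + q = m + p + r"
      using bal rq n m s real by (simp flip: ennreal_plus)
    then show ?thesis
      using rq n m s real by (simp add: enn2ereal_ennreal)
  next
    case top
    \<comment> \<open>The right side of \<open>bal\<close> is infinite while \<open>n\<close> and
      \<open>q\<close> are finite.\<close>
    then have "I (\<lambda>x. F x + G x) = \<infinity>"
      using bal by (cases "I (\<lambda>x. F x + G x)") (use n rq in \<open>auto simp flip: ennreal_plus\<close>)
    then show ?thesis
      using top by simp
  qed
  moreover have "integral\<^sup>L lebesgue G = (LINT x:S|lebesgue. g x)"
    by (simp add: set_lebesgue_integral_def G_def[abs_def])
  ultimately show ?thesis
    using rq n m unfolding ext_integral_def I_eq by (simp add: enn2ereal_ennreal)
qed

text \<open>The inequality ln z \<le> z - 1 at z = 1/y, multiplied by y, gives y ln y \<ge> y - 1.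
  This cruder bound than -1/e suffices to make the negative part of the entropy integrand integrable
  over a bounded interval.\<close>

lemma mult_ln_ge_minus_one:
  fixes y :: real
  assumes "0 \<le> y"
  shows "- 1 \<le> y * ln y"
proof (cases "y = 0")
  case False
  then have "- ln y \<le> 1 / y - 1"
    using assms ln_le_minus_one[of "1 / y"] by (simp add: ln_div)
  then have "y * (- ln y) \<le> y * (1 / y - 1)"
    using assms by (intro mult_left_mono)
  then show ?thesis
    using False assms by (simp add: algebra_simps)
qed simp

lemma cross_entropy_uniform:
  assumes "K \<ge> 1" and u: "u \<in> utility_densities K"
  shows "ext_integral {0..real K} (\<lambda>x. u x * ln (u x / uniform_density K x))
      = ext_integral {0..real K} (\<lambda>x. u x * ln (u x)) + ereal (ln (real K))"
proof -
  let ?S = "{0..real K}"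
  have nonneg: "0 \<le> u x" if "x \<in> ?S" for x
    using u that by (auto simp: utility_densities_def)
  have int: "set_integrable lebesgue ?S u" and one: "(LINT x:?S|lebesgue. u x) = 1"
    using u by (auto simp: utility_densities_def)
  have [measurable]: "(\<lambda>x. indicator ?S x *\<^sub>R u x) \<in> borel_measurable lebesgue"
    using int by (auto simp: set_integrable_def)
  \<comment> \<open>Measurability of \<open>u\<close> is known only after multiplication by the
    indicator, so the indicator first goes inside the logarithm; off the interval both forms are
    0.\<close>
  have "(\<lambda>x. (indicator ?S x *\<^sub>R u x) * ln (indicator ?S x *\<^sub>R u x)) \<in> borel_measurable lebesgue"
    by measurable
  also have "(\<lambda>x. (indicator ?S x *\<^sub>R u x) * ln (indicator ?S x *\<^sub>R u x))
      = (\<lambda>x. indicator ?S x *\<^sub>R (u x * ln (u x)))"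
    by (auto simp: indicator_def)
  finally have meas: "set_borel_measurable lebesgue ?S (\<lambda>x. u x * ln (u x))"
    by (simp add: set_borel_measurable_def)
  have "(\<integral>\<^sup>+x\<in>?S. ennreal (- (u x * ln (u x))) \<partial>lebesgue) \<le> (\<integral>\<^sup>+x. indicator ?S x \<partial>lebesgue)"
    by (intro nn_integral_mono)
      (auto simp: indicator_def intro!: ennreal_le_1[THEN iffD2] mult_ln_ge_minus_one nonneg)
  also have "\<dots> < \<infinity>"
    by simp
  finally have neg: "(\<integral>\<^sup>+x\<in>?S. ennreal (- (u x * ln (u x))) \<partial>lebesgue) < \<infinity>" .
  have "ext_integral ?S (\<lambda>x. u x * ln (u x / uniform_density K x))
      = ext_integral ?S (\<lambda>x. u x * ln (u x) + u x * ln (real K))"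
  proof (rule ext_integral_cong)
    fix x assume x: "x \<in> ?S"
    \<comment> \<open>If \<open>u x = 0\<close>, the factor \<open>u x\<close> annihilates every
      term. Otherwise \<open>u x\<close> and \<open>K\<close> are positive and the logarithm of
      their product splits.\<close>
    show "u x * ln (u x / uniform_density K x) = u x * ln (u x) + u x * ln (real K)"
      using nonneg[OF x] x \<open>K \<ge> 1\<close>
      by (cases "u x = 0") (auto simp: uniform_density_def ln_mult algebra_simps)
  qed
  also have "\<dots> = ext_integral ?S (\<lambda>x. u x * ln (u x)) + ereal (LINT x:?S|lebesgue. u x * ln (real K))"
    using int by (intro ext_integral_add meas neg) simp
  \<comment> \<open>The normalisation of \<open>u\<close> reduces the added integral to
    \<open>ln (real K)\<close>, the same constant for every density.\<close>
  finally show ?thesis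
    using one by simp
qed

theorem corollary3:
  fixes K :: nat and C :: "preference set"
  assumes "K \<ge> 1"
    and "finite C"
    and "\<forall>c\<in>C. rank c \<in> {1..K}"
  shows "{u. is_arg_max (\<lambda>u. - ext_integral {0..real K} (\<lambda>x. u x * ln (u x)))
               (\<lambda>u. u \<in> preference_context K C) u}
       = {u. is_arg_min (\<lambda>u. ext_integral {0..real K} (\<lambda>x. u x * ln (u x / uniform_density K x)))
               (\<lambda>u. u \<in> preference_context K C) u}"
proof -
  \<comment> \<open>Adding a finite real preserves strict order even at infinite values, and
    negation reverses it; this matches the comparisons in \<open>is_arg_min\<close> with those in
    \<open>is_arg_max\<close>.\<close>
  have less_iff: "a + ereal c < b + ereal c \<longleftrightarrow> - b < - a" for a b :: ereal and c
    by (cases a; cases b) auto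
  have "ext_integral {0..real K} (\<lambda>x. u x * ln (u x / uniform_density K x))
      = ext_integral {0..real K} (\<lambda>x. u x * ln (u x)) + ereal (ln (real K))"
    if "u \<in> preference_context K C" for u
    using that assms(1) by (intro cross_entropy_uniform) (auto simp: preference_context_def)
  then show ?thesis
    by (auto simp: is_arg_max_def is_arg_min_def less_iff)
qed

end
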